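(* Let $G$ be a nilpotent torsion-free group such that $\mathcal{GP}(G)$ is complete. Then $G$ is abelian.
   Context: For a group $G$, the generalized power graph $\mathcal{GP}(G)$ is the simple undirected graph whose vertices are the non-identity elements of $G$, two distinct vertices $a,b$ being adjacent if and only if $\langle a\rangle\cap\langle b\rangle\neq 1$. A graph is complete if any two distinct vertices are adjacent; the graph with no vertices (the case of the trivial group) counts as complete. *)

theory Defs
  imports "HOL-Algebra.Algebra" "Graph_Theory.Pair_Digraph"
begin

definition group_center :: "('a, 'b) monoid_scheme \<Rightarrow> 'a set" where
  "group_center G = {z \<in> carrier G. \<forall>x \<in> carrier G. z \<otimes>\<^bsub>G\<^esub> x = x \<otimes>\<^bsub>G\<^esub> z}"

(* A finite ascending central series {1} = H 0 <= H 1 <= ... <= H n = G: every H i is normal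
   in G and every factor H (i+1) / H i is contained in the centre of G / H i. *)
definition central_series :: "('a, 'b) monoid_scheme \<Rightarrow> (nat \<Rightarrow> 'a set) \<Rightarrow> nat \<Rightarrow> bool" where
  "central_series G H n \<longleftrightarrow>
     H 0 = {\<one>\<^bsub>G\<^esub>} \<and> H n = carrier G \<and>
     (\<forall>i \<le> n. H i \<lhd> G) \<and>
     (\<forall>i < n. H i \<subseteq> H (Suc i) \<and>
        (\<lambda>x. H i #>\<^bsub>G\<^esub> x) ` H (Suc i) \<subseteq> group_center (G Mod H i))"

definition nilpotent_group :: "('a, 'b) monoid_scheme \<Rightarrow> bool" where
  "nilpotent_group G \<longleftrightarrow> group G \<and> (\<exists>H n. central_series G H n)"

(* group.ord G x = 0 is the library's encoding of infinite order. *)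
definition torsion_free_group :: "('a, 'b) monoid_scheme \<Rightarrow> bool" where
  "torsion_free_group G \<longleftrightarrow>
     group G \<and> (\<forall>x \<in> carrier G. x \<noteq> \<one>\<^bsub>G\<^esub> \<longrightarrow> group.ord G x = 0)"

(* A simple undirected graph is represented as a loop-free symmetric set of ordered pairs.
   The locale pair_graph is not used because it requires finitely many vertices. *)
definition generalized_power_graph :: "('a, 'b) monoid_scheme \<Rightarrow> 'a pair_pre_digraph" where
  "generalized_power_graph G =
     \<lparr> pverts = carrier G - {\<one>\<^bsub>G\<^esub>},
       parcs = {(a, b). a \<in> carrier G - {\<one>\<^bsub>G\<^esub>} \<and> b \<in> carrier G - {\<one>\<^bsub>G\<^esub>} \<and> a \<noteq> b \<and>
                  generate G {a} \<inter> generate G {b} \<noteq> {\<one>\<^bsub>G\<^esub>}} \<rparr>"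

lemma generalized_power_graph_bidirected:
  "pair_bidirected_digraph (generalized_power_graph G)"
  by unfold_locales
    (auto simp: generalized_power_graph_def symmetric_def with_proj_def arcs_ends_conv sym_def image_iff)

(* Unlike the library's complete_digraph n, this does not restrict to finite graphs. *)
definition complete_graph :: "'a pair_pre_digraph \<Rightarrow> bool" where
  "complete_graph \<Gamma> \<longleftrightarrow>
     (\<forall>a \<in> pverts \<Gamma>. \<forall>b \<in> pverts \<Gamma>. a \<noteq> b \<longrightarrow> (a, b) \<in> parcs \<Gamma>)"

end

theory Submission
  imports Defs
begin

text \<open>
  By induction, every term of the central series lies in the centre. Suppose \<open>H i\<close> does, take
  \<open>g \<in> H (i + 1)\<close> and any \<open>x\<close>, and let \<open>c \<in> H i\<close> be the commutator of \<open>x\<close> and \<open>g\<close>; it is central.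
  If \<open>c \<noteq> 1\<close>, completeness of the graph provides a common power \<open>x\<^sup>k = c\<^sup>m \<noteq> 1\<close>, so \<open>x\<^sup>k\<close> is
  central. Raising \<open>x = c (g x g\<^sup>-\<^sup>1)\<close> to the power \<open>k\<close> gives \<open>x\<^sup>k = c\<^sup>k x\<^sup>k\<close>, so \<open>c\<^sup>k = 1\<close> with
  \<open>k \<noteq> 0\<close>, contradicting torsion-freeness.
\<close>

text \<open>The cosets of \<open>g\<close> and \<open>x\<close> commute in the quotient, so
  \<open>x \<otimes> g\<close> lies in the coset of \<open>g \<otimes> x\<close>, and their quotient
  falls into \<open>H\<close>.\<close>

lemma (in group) commutator_in_of_central_factor:
  assumes "H \<lhd> G" "H #> g \<in> group_center (G Mod H)" "g \<in> carrier G" "x \<in> carrier G"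
  shows "x \<otimes> g \<otimes> inv (g \<otimes> x) \<in> H"
proof -
  interpret N: normal H G by fact
  have "H #> x \<in> carrier (G Mod H)"
    using \<open>x \<in> carrier G\<close> by (auto simp: FactGroup_def RCOSETS_def)
  then have "(H #> g) <#> (H #> x) = (H #> x) <#> (H #> g)"
    using assms(2) by (simp add: group_center_def)
  then have "H #> (x \<otimes> g) = H #> (g \<otimes> x)"
    using assms(3,4) by (simp add: N.rcos_sum)
  then show ?thesis
    using assms(3,4) N.rcos_module_imp[OF is_group] rcos_self[OF _ N.subgroup_axioms]
    by (metis m_closed)
qed

lemma (in group) int_pow_conj:
  assumes "g \<in> carrier G" "x \<in> carrier G"
  shows "(g \<otimes> x \<otimes> inv g) [^] (n::int) = g \<otimes> x [^] n \<otimes> inv g"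
proof -
  have "(\<lambda>y. g \<otimes> y \<otimes> inv g) \<in> hom G G"
    using assms(1) by (auto simp: hom_def m_assoc inv_solve_left)
  from hom_int_pow[OF this assms(2) is_group is_group, of n] show ?thesis
    by simp
qed

text \<open>Conjugation by any \<open>x\<close> fixes \<open>c\<close>, hence by
  \<open>int_pow_conj\<close> it fixes every power of \<open>c\<close>.\<close>

lemma (in group) group_center_int_pow_closed:
  assumes "c \<in> group_center G"
  shows "c [^] (n::int) \<in> group_center G"
proof -
  have cG: "c \<in> carrier G"
    using assms by (simp add: group_center_def)
  have "c [^] n \<otimes> x = x \<otimes> c [^] n" if x: "x \<in> carrier G" for x
  proof -
    have "x \<otimes> c \<otimes> inv x = c"
      using assms x by (auto simp: group_center_def inv_solve_right')
    then show ?thesis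
      using int_pow_conj[OF x cG, of n] x cG by (metis int_pow_closed inv_solve_right m_closed)
  qed
  then show ?thesis
    using cG by (simp add: group_center_def)
qed

text \<open>As \<open>c\<close> is central, \<open>x\<close> is the conjugate of
  \<open>c \<otimes> x\<close> by \<open>g\<close>. Taking powers, the conjugation cancels because
  \<open>x [^] n\<close> is central, which leaves
  \<open>(c \<otimes> x) [^] n = x [^] n\<close>.\<close>

lemma (in group) commutator_central_imp_power_eq_one:
  assumes "g \<in> carrier G" "x \<in> carrier G" "c \<in> group_center G"
    and c: "x \<otimes> g = c \<otimes> (g \<otimes> x)"
    and "x [^] (n::int) \<in> group_center G"
  shows "c [^] n = \<one>"
proof -
  have cG: "c \<in> carrier G" and cx: "c \<otimes> x = x \<otimes> c" and cg: "c \<otimes> g = g \<otimes> c"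
    using assms by (auto simp: group_center_def)
  have xn: "g \<otimes> x [^] n = x [^] n \<otimes> g"
    using assms by (simp add: group_center_def)
  have "x = c \<otimes> (g \<otimes> x \<otimes> inv g)"
    using c cG assms(1,2) by (metis inv_closed inv_solve_right m_assoc m_closed)
  also have "\<dots> = g \<otimes> (c \<otimes> x) \<otimes> inv g"
    using cG cg assms(1,2) by (metis inv_closed m_assoc m_closed)
  finally have "x [^] n = g \<otimes> (c \<otimes> x) [^] n \<otimes> inv g"
    using int_pow_conj[of g "c \<otimes> x" n] cG assms(1,2) by simp
  then have "g \<otimes> (c \<otimes> x) [^] n = x [^] n \<otimes> g"
    using cG assms(1,2) by (metis int_pow_closed inv_solve_right m_closed)
  then have "(c \<otimes> x) [^] n = x [^] n"
    using xn cG assms(1,2) by (metis int_pow_closed l_cancel m_closed)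
  then have "c [^] n \<otimes> x [^] n = x [^] n"
    using int_pow_mult_distrib[OF cx cG assms(2)] by simp
  then show ?thesis
    using cG assms(2) by (metis int_pow_closed l_cancel_one' r_cancel_one)
qed

text \<open>Two cyclic subgroups always share \<open>\<one>\<close>, so adjacency supplies a further
  common element, which is an integer power of both generators.\<close>

lemma (in group) complete_generalized_power_graph_common_power:
  assumes "complete_graph (generalized_power_graph G)"
    and "a \<in> carrier G" "b \<in> carrier G" "a \<noteq> \<one>" "b \<noteq> \<one>" "a \<noteq> b"
  obtains m n :: int where "a [^] m = b [^] n" "a [^] m \<noteq> \<one>"
proof -
  have "generate G {a} \<inter> generate G {b} \<noteq> {\<one>}"
    using assms by (auto simp: complete_graph_def generalized_power_graph_def)
  moreover have "\<one> \<in> generate G {a} \<inter> generate G {b}"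
    by (simp add: generate.one)
  ultimately obtain y where "y \<in> generate G {a}" "y \<in> generate G {b}" "y \<noteq> \<one>"
    by blast
  then show thesis
    using that assms(2,3) by (auto simp: generate_pow)
qed

lemma (in group) central_series_subset_center:
  assumes "torsion_free_group G" "complete_graph (generalized_power_graph G)"
    and H: "central_series G H n"
  shows "i \<le> n \<Longrightarrow> H i \<subseteq> group_center G"
proof (induction i)
  case 0
  then show ?case
    using H by (auto simp: central_series_def group_center_def)
next
  case (Suc i)
  have "g \<otimes> x = x \<otimes> g" if g: "g \<in> H (Suc i)" "g \<in> carrier G" and x: "x \<in> carrier G" for g x
  proof (rule ccontr)
    assume ne: "g \<otimes> x \<noteq> x \<otimes> g"
    define c where "c = x \<otimes> g \<otimes> inv (g \<otimes> x)"
    have "H i \<lhd> G" "(#>) (H i) ` H (Suc i) \<subseteq> group_center (G Mod H i)"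
      using H Suc.prems by (auto simp: central_series_def)
    then have "c \<in> H i"
      unfolding c_def using g x by (intro commutator_in_of_central_factor) blast+
    then have c: "c \<in> group_center G"
      using Suc by auto
    then have cG: "c \<in> carrier G"
      by (simp add: group_center_def)
    have eq: "x \<otimes> g = c \<otimes> (g \<otimes> x)"
      using g x by (simp add: c_def m_assoc)
    have "c \<noteq> \<one>"
      using eq ne g x by auto
    moreover have "x \<noteq> \<one>"
      using ne g by auto
    \<comment> \<open>Completeness speaks only of distinct vertices. Here \<open>c\<close> is
      central, while \<open>x\<close> fails to commute with \<open>g\<close>.\<close>
    moreover have "x \<noteq> c"
      using ne c g by (auto simp: group_center_def)
    ultimately obtain k m :: int where km: "x [^] k = c [^] m" "x [^] k \<noteq> \<one>"
      using complete_generalized_power_graph_common_power[OF assms(2) x cG] by metis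
    have "x [^] k \<in> group_center G"
      using group_center_int_pow_closed[OF c] km(1) by simp
    then have "c [^] k = \<one>"
      using commutator_central_imp_power_eq_one g x c eq by blast
    moreover have "ord c = 0"
      using assms(1) cG \<open>c \<noteq> \<one>\<close> by (simp add: torsion_free_group_def)
    \<comment> \<open>The order of \<open>c\<close> divides \<open>k\<close>, and 0 divides only
      0.\<close>
    ultimately have "k = 0"
      using int_pow_eq_id[OF cG] by simp
    then show False
      using km(2) by simp
  qed
  \<comment> \<open>Normality puts \<open>H (Suc i)\<close> inside the carrier, which discharges the
    premise \<open>g \<in> carrier G\<close> above.\<close>
  moreover have "H (Suc i) \<lhd> G"
    using H Suc.prems by (simp add: central_series_def)
  then have "H (Suc i) \<subseteq> carrier G"
    by (intro subgroup.subset normal_imp_subgroup)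
  ultimately show ?case
    by (auto simp: group_center_def)
qed

theorem theorem3p2:
  fixes G :: "('a, 'b) monoid_scheme"
  assumes "group G"
    and "nilpotent_group G"
    and "torsion_free_group G"
    and "complete_graph (generalized_power_graph G)"
  shows "comm_group G"
proof -
  interpret group G by fact
  obtain H n where H: "central_series G H n"
    using assms(2) by (auto simp: nilpotent_group_def)
  \<comment> \<open>The last term \<open>H n\<close> of the series is the whole group.\<close>
  have "carrier G \<subseteq> group_center G"
    using central_series_subset_center[OF assms(3,4) H, of n] H by (simp add: central_series_def)
  then show ?thesis
    by (intro group_comm_groupI) (auto simp: group_center_def)
qed

end
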